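(* Let $n$ be a positive integer, let $a,b$ be non-negative integers and let $c\ge 2$ be an integer. Then $$S_n(\{2\}^a,c,\{2\}^b)=2\sum_{k=1}^n \frac{(-1)^{k-1}\binom{n}{k}}{k^{2a+2b+c}\binom{n+k}{k}}+4\sum_{\substack{i\ge 1,\ j\ge 2,\ |\mathbf{s}|\ge 0\\ i+j+|\mathbf{s}|=c}}2^{l(\mathbf{s})}\sum_{k=1}^n\frac{H_{k-1}(2a+i,\mathbf{s})\,(-1)^{k-1}\binom{n}{k}}{k^{2b+j}\binom{n+k}{k}},$$ where the outer sum in the second term runs over all integers $i\ge 1$, $j\ge 2$ and all finite (possibly empty) sequences $\mathbf{s}=(s_1,\dots,s_r)$ of positive integers, $r\ge 0$, with $i+j+|\mathbf{s}|=c$.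
   Context: For a sequence $\mathbf{s}=(s_1,\dots,s_r)$ of positive integers and an integer $n\ge 0$: $H_n(\mathbf{s})=\sum_{1\le k_1<k_2<\cdots<k_r\le n}\frac{1}{k_1^{s_1}\cdots k_r^{s_r}}$ and $S_n(\mathbf{s})=\sum_{1\le k_1\le\cdots\le k_r\le n}\frac{1}{k_1^{s_1}\cdots k_r^{s_r}}$. Conventions: $H_n(\mathbf{s})=0$ if $n<r$, and $H_n(\emptyset)=S_n(\emptyset)=1$. The length is $l(\mathbf{s})=r$ and the weight is $|\mathbf{s}|=s_1+\cdots+s_r$ (both $0$ for the empty sequence). $\{2\}^a$ denotes $2$ repeated $a$ times; $H_{k-1}(2a+i,\mathbf{s})$ means $H_{k-1}(2a+i,s_1,\dots,s_r)$. *)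

theory Defs
  imports Complex_Main
begin

text \<open>
  The finite multiple harmonic sums, with exponent sequences and index tuples
  \<open>(k\<^sub>1, \<dots>, k\<^sub>r)\<close> as lists. The exponents are meant to be positive; the definitions do not impose
  this. For the empty exponent sequence both values are 1 (the empty list is the only index tuple),
  and the strict sum is 0 for \<open>n < length s\<close>, as no index tuple exists.
\<close>

definition mhs :: "nat \<Rightarrow> nat list \<Rightarrow> real" where
  "mhs n s = (\<Sum>ks | length ks = length s \<and> sorted_wrt (<) ks \<and> set ks \<subseteq> {1..n}.
                1 / (\<Prod>i<length s. real (ks ! i) ^ (s ! i)))"

definition mhs_star :: "nat \<Rightarrow> nat list \<Rightarrow> real" where
  "mhs_star n s = (\<Sum>ks | length ks = length s \<and> sorted_wrt (\<le>) ks \<and> set ks \<subseteq> {1..n}.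
                     1 / (\<Prod>i<length s. real (ks ! i) ^ (s ! i)))"

definition split_index :: "nat \<Rightarrow> (nat \<times> nat \<times> nat list) set" where
  "split_index c = {(i, j, s). i \<ge> 1 \<and> j \<ge> 2 \<and> (\<forall>x\<in>set s. x \<ge> 1) \<and> i + j + sum_list s = c}"

text \<open>All the index sets are finite, so none of the sums is zero by default.\<close>

lemma finite_index_tuples:
  "finite {ks :: nat list. length ks = r \<and> sorted_wrt R ks \<and> set ks \<subseteq> {1..n}}"
  by (rule finite_subset[OF _ finite_lists_length_eq[of "{1..n}" r]]) auto

lemma finite_split_index: "finite (split_index c)"
proof -
  have len: "length s \<le> sum_list s" if "\<forall>x\<in>set s. x \<ge> 1" for s :: "nat list"
    using that by (induction s) auto
  have "split_index c \<subseteq> {..c} \<times> {..c} \<times> {s. set s \<subseteq> {..c} \<and> length s \<le> c}"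
    unfolding split_index_def using len by (fastforce dest: member_le_sum_list)
  then show ?thesis
    by (rule finite_subset) (auto intro: finite_lists_length_le)
qed

end

theory Submission
  imports Defs
begin

text \<open>
  Write \<open>f\<^sub>n(k) = (-1)\<^bsup>k-1\<^esup> (n choose k) / ((n + k) choose k)\<close> for the kernel. It behaves well under both of
  its arguments. From \<open>(n\<^sup>2 - k\<^sup>2) f\<^sub>n(k) = n\<^sup>2 f\<^bsub>n-1\<^esub>(k)\<close> it follows that passing from \<open>n - 1\<close> to \<open>n\<close>
  changes \<open>\<Sum>\<^sub>k f\<^sub>n(k) w(k)\<close> by \<open>n\<^sup>-\<^sup>2 \<Sum>\<^sub>k f\<^sub>n(k) k\<^sup>2 w(k)\<close> (\<open>sum_kern_Suc\<close>), whereas appending an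
  exponent \<open>x\<close> to \<open>s\<close> makes the step of \<open>S\<close> from \<open>n - 1\<close> to \<open>n\<close> equal to \<open>n\<^sup>-\<^sup>x S\<^sub>n(s)\<close>. For \<open>x = 2\<close> the two
  recursions match, so each trailing 2 costs a factor \<open>k\<^sup>-\<^sup>2\<close> under the kernel sum. Starting from
  \<open>2 \<Sum>\<^sub>k f\<^sub>n(k) = 1\<close>, this gives \<open>S\<^sub>n({2}\<^sup>a) = 2 \<Sum>\<^sub>k f\<^sub>n(k) k\<^bsup>-2a\<^esup>\<close>, and it reduces the theorem to \<open>b = 0\<close>.

  The right-hand side of the theorem is \<open>2 \<Sum>\<^sub>k f\<^sub>n(k) k\<^bsup>-2b-2\<^esup> U\<^sub>d(k)\<close> with \<open>d = c - 2\<close> and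
  \<open>U\<^sub>d(k) = k\<^bsup>-2a-d\<^esup> + 2 \<Sum>\<^sub>j B\<^bsub>d-j\<^esub>(k - 1) k\<^sup>-\<^sup>j\<close>, where \<open>B\<^sub>d(n)\<close> collects the terms
  \<open>2\<^bsup>l(s)\<^esup> H\<^sub>n(2a + i, s)\<close> with \<open>i + |s| = d\<close>. By the recursion in \<open>n\<close>, appending the exponent \<open>c\<close> to
  \<open>{2}\<^sup>a\<close> therefore comes down to
  \<open>\<Sum>\<^sub>k f\<^sub>n(k) U\<^sub>d(k) = n\<^sup>-\<^sup>d \<Sum>\<^sub>k f\<^sub>n(k) k\<^bsup>-2a\<^esup>\<close> (\<open>sum_kern_split_sum\<close>), that is, to replacing the weight
  \<open>U\<^sub>d\<close> by \<open>U\<^bsub>d+1\<^esub>\<close> dividing the sum by \<open>n\<close>. The definition of \<open>U\<close> gives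
  \<open>k U\<^bsub>d+1\<^esub>(k) - U\<^sub>d(k) = 2 k B\<^bsub>d+1\<^esub>(k - 1)\<close>, and splitting off the largest index of \<open>B\<close> gives
  \<open>U\<^bsub>d+1\<^esub>(k) = B\<^bsub>d+1\<^esub>(k) + B\<^bsub>d+1\<^esub>(k - 1)\<close>. Hence
  \<open>n U\<^bsub>d+1\<^esub>(k) - U\<^sub>d(k) = (n - k) B\<^bsub>d+1\<^esub>(k) + (n + k) B\<^bsub>d+1\<^esub>(k - 1)\<close>, and the relation
  \<open>(n + k + 1) f\<^sub>n(k + 1) = -(n - k) f\<^sub>n(k)\<close> makes the sum of this against \<open>f\<^sub>n\<close> telescope to
  \<open>n B\<^bsub>d+1\<^esub>(0) = 0\<close> (\<open>sum_kern_telescope\<close>).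
\<close>

section \<open>Sums over monotone index tuples\<close>

definition index_tuples :: "(nat \<Rightarrow> nat \<Rightarrow> bool) \<Rightarrow> nat \<Rightarrow> nat \<Rightarrow> nat list set" where
  "index_tuples R n r = {ks. length ks = r \<and> sorted_wrt R ks \<and> set ks \<subseteq> {1..n}}"

text \<open>
  With the order as a parameter, the recursion in \<open>n\<close> is proved only once for the strict and the
  non-strict sums.
\<close>

definition tuple_sum :: "(nat \<Rightarrow> nat \<Rightarrow> bool) \<Rightarrow> nat \<Rightarrow> nat list \<Rightarrow> real" where
  "tuple_sum R n s =
     (\<Sum>ks\<in>index_tuples R n (length s). 1 / (\<Prod>i<length s. real (ks ! i) ^ (s ! i)))"

lemma mhs_eq_tuple_sum: "mhs = tuple_sum (<)"
  by (intro ext) (simp add: mhs_def tuple_sum_def index_tuples_def)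

lemma mhs_star_eq_tuple_sum: "mhs_star = tuple_sum (\<le>)"
  by (intro ext) (simp add: mhs_star_def tuple_sum_def index_tuples_def)

lemma finite_set_index_tuples: "finite (index_tuples R n r)"
  unfolding index_tuples_def by (rule finite_index_tuples)

lemma tuple_sum_Nil: "tuple_sum R n [] = 1"
proof -
  have "index_tuples R n 0 = {[]}"
    by (auto simp: index_tuples_def)
  then show ?thesis by (simp add: tuple_sum_def)
qed

lemma tuple_sum_0:
  assumes "s \<noteq> []"
  shows "tuple_sum R 0 s = 0"
proof -
  have "index_tuples R 0 (length s) = {}"
    using assms by (auto simp: index_tuples_def)
  then show ?thesis by (simp add: tuple_sum_def)
qed

text \<open>
  A monotone tuple with entries up to \<open>n + 1\<close> either avoids \<open>n + 1\<close> or has it as its last entry;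
  in the second case \<open>m\<close> bounds the remaining entries (\<open>m = n\<close> for \<open><\<close>, and \<open>m = n + 1\<close> for \<open>\<le>\<close>).
\<close>

lemma index_tuples_Suc:
  assumes le: "\<And>x y. R x y \<Longrightarrow> x \<le> y"
    and top: "\<And>x. x \<le> Suc n \<Longrightarrow> R x (Suc n) \<longleftrightarrow> x \<le> m"
    and m: "m \<le> Suc n"
  shows "index_tuples R (Suc n) (Suc r) =
           index_tuples R n (Suc r) \<union> (\<lambda>ks. ks @ [Suc n]) ` index_tuples R m r"
    (is "?L = ?A \<union> ?B")
proof (intro equalityI subsetI)
  fix ks assume ks: "ks \<in> ?L"
  then obtain ls l where eq: "ks = ls @ [l]"
    by (cases ks rule: rev_cases) (auto simp: index_tuples_def)
  have len: "length ls = r" and sl: "sorted_wrt R ls" and Rl: "\<forall>x\<in>set ls. R x l"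
    and rng: "set ls \<subseteq> {1..Suc n}" and l: "1 \<le> l" "l \<le> Suc n"
    using ks by (auto simp: index_tuples_def eq sorted_wrt_append)
  show "ks \<in> ?A \<union> ?B"
  proof (cases "l = Suc n")
    case True
    have "set ls \<subseteq> {1..m}"
      using Rl rng top True by fastforce
    then show ?thesis
      using len sl True eq by (auto simp: index_tuples_def)
  next
    case False
    then have "l \<le> n" using l by simp
    moreover have "x \<le> l" if "x \<in> set ls" for x using Rl le that by blast
    ultimately have "set ls \<subseteq> {1..n}" using rng by fastforce
    then show ?thesis
      using len sl Rl l \<open>l \<le> n\<close> eq by (auto simp: index_tuples_def sorted_wrt_append)
  qed
next
  fix ks assume "ks \<in> ?A \<union> ?B"
  then show "ks \<in> ?L"
  proof
    assume "ks \<in> ?A"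
    then show ?thesis by (fastforce simp: index_tuples_def)
  next
    assume "ks \<in> ?B"
    then obtain ls where ls: "ks = ls @ [Suc n]" "ls \<in> index_tuples R m r" by blast
    have "R x (Suc n) \<and> 1 \<le> x \<and> x \<le> Suc n" if "x \<in> set ls" for x
      using ls(2) that m top[of x] by (force simp: index_tuples_def)
    then show ?thesis
      using ls by (auto simp: index_tuples_def sorted_wrt_append)
  qed
qed

lemma tuple_sum_Suc_snoc:
  assumes le: "\<And>x y. R x y \<Longrightarrow> x \<le> y"
    and top: "\<And>x. x \<le> Suc n \<Longrightarrow> R x (Suc n) \<longleftrightarrow> x \<le> m"
    and m: "m \<le> Suc n"
  shows "tuple_sum R (Suc n) (s @ [x]) =
           tuple_sum R n (s @ [x]) + tuple_sum R m s / real (Suc n) ^ x"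
proof -
  let ?w = "\<lambda>s ks. 1 / (\<Prod>i<length s. real (ks ! i) ^ (s ! i))"
  let ?snoc = "\<lambda>ks. ks @ [Suc n]"
  have index_tuples_eq: "index_tuples R (Suc n) (Suc (length s)) =
      index_tuples R n (Suc (length s)) \<union> ?snoc ` index_tuples R m (length s)"
    using le top m by (rule index_tuples_Suc)
  have disj: "index_tuples R n (Suc (length s)) \<inter> ?snoc ` index_tuples R m (length s) = {}"
    by (auto simp: index_tuples_def)
  have "tuple_sum R (Suc n) (s @ [x]) =
      (\<Sum>ks\<in>index_tuples R (Suc n) (Suc (length s)). ?w (s @ [x]) ks)"
    by (simp only: tuple_sum_def length_append_singleton)
  also have "\<dots> = (\<Sum>ks\<in>index_tuples R n (Suc (length s)). ?w (s @ [x]) ks)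
      + (\<Sum>ks\<in>?snoc ` index_tuples R m (length s). ?w (s @ [x]) ks)"
    unfolding index_tuples_eq
    by (rule sum.union_disjoint) (use disj finite_set_index_tuples in auto)
  also have "(\<Sum>ks\<in>?snoc ` index_tuples R m (length s). ?w (s @ [x]) ks) =
      (\<Sum>ks\<in>index_tuples R m (length s). ?w (s @ [x]) (?snoc ks))"
    by (subst sum.reindex) (auto simp: inj_on_def)
  also have "\<dots> = (\<Sum>ks\<in>index_tuples R m (length s). ?w s ks / real (Suc n) ^ x)"
    by (intro sum.cong refl) (auto simp: index_tuples_def nth_append)
  also have "\<dots> = tuple_sum R m s / real (Suc n) ^ x"
    by (simp only: tuple_sum_def sum_divide_distrib)
  finally show ?thesis
    by (simp only: tuple_sum_def length_append_singleton)
qed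

lemma mhs_Suc_snoc:
  "mhs (Suc n) (s @ [x]) = mhs n (s @ [x]) + mhs n s / real (Suc n) ^ x"
  unfolding mhs_eq_tuple_sum by (rule tuple_sum_Suc_snoc) auto

lemma mhs_star_Suc_snoc:
  "mhs_star (Suc n) (s @ [x]) = mhs_star n (s @ [x]) + mhs_star (Suc n) s / real (Suc n) ^ x"
  unfolding mhs_star_eq_tuple_sum by (rule tuple_sum_Suc_snoc) auto

section \<open>The binomial kernel\<close>

definition kern :: "nat \<Rightarrow> nat \<Rightarrow> real" where
  "kern n k = (-1) ^ (k - 1) * real (n choose k) / real ((n + k) choose k)"

lemma kern_eq_0: "n < k \<Longrightarrow> kern n k = 0"
  by (simp add: kern_def)

lemma kern_Suc_right:
  assumes "1 \<le> k" "k \<le> n"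
  shows "(real n + real k + 1) * kern n (Suc k) = - (real n - real k) * kern n k"
proof -
  have "(n choose Suc k) * Suc k = (n choose k) * (n - k)"
    using binomial_absorb_comp[of n k] binomial_absorption[of k n] by (simp add: mult.commute)
  then have "real ((n choose Suc k) * Suc k) = real ((n choose k) * (n - k))" by simp
  then have num: "real (n choose Suc k) = real (n choose k) * (real n - real k) / (real k + 1)"
    using assms by (simp add: of_nat_diff field_simps)
  have "real (Suc k * (Suc (n + k) choose Suc k)) = real (Suc (n + k) * ((n + k) choose k))"
    by (simp only: Suc_times_binomial)
  then have den: "real ((n + Suc k) choose Suc k) =
      real ((n + k) choose k) * (real n + real k + 1) / (real k + 1)"
    by (simp add: field_simps del: binomial_Suc_Suc)
  have sign: "(-1 :: real) ^ (Suc k - 1) = - ((-1) ^ (k - 1))"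
    using assms by (cases k) auto
  have "real n + real k + 1 \<noteq> 0" "real k + 1 \<noteq> 0" by linarith+
  then show ?thesis
    unfolding kern_def num den sign by (simp add: divide_simps) (simp add: algebra_simps)
qed

lemma kern_Suc_left:
  assumes "k \<le> Suc n"
  shows "kern (Suc n) k * (real (Suc n) ^ 2 - real k ^ 2) = real (Suc n) ^ 2 * kern n k"
proof -
  define N where "N = real (Suc n)"
  have "real ((Suc n - k) * (Suc n choose k)) = real (Suc n * (n choose k))"
    using binomial_absorb_comp[of "Suc n" k] by simp
  then have num: "real (Suc n choose k) * (N - real k) = N * real (n choose k)"
    unfolding of_nat_mult of_nat_diff[OF assms] N_def by (simp only: mult.commute)
  have "real ((Suc (n + k) - k) * (Suc (n + k) choose k)) = real (Suc (n + k) * ((n + k) choose k))"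
    using binomial_absorb_comp[of "Suc (n + k)" k] by simp
  then have "N * real ((Suc n + k) choose k) = (N + real k) * real ((n + k) choose k)"
    by (simp add: N_def algebra_simps Suc_diff_le)
  moreover have pos: "N > 0" "N + real k > 0" "real ((n + k) choose k) > 0"
    by (simp_all add: N_def)
  ultimately have den: "real ((Suc n + k) choose k) = (N + real k) * real ((n + k) choose k) / N"
    by (simp add: field_simps)
  have cancel: "e * P / (M * q / N) * (M * D) = e * (P * D) * N / q"
    if "M > 0" "q > 0" for e P M q D :: real
    using that pos(1) by simp
  have "N ^ 2 - real k ^ 2 = (N + real k) * (N - real k)"
    by (simp add: power2_eq_square square_diff_square_factored)
  then have "kern (Suc n) k * (N ^ 2 - real k ^ 2) =
      (-1) ^ (k - 1) * (real (Suc n choose k) * (N - real k)) * N / real ((n + k) choose k)"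
    unfolding kern_def den by (simp only: cancel[OF pos(2,3)])
  also have "\<dots> = N ^ 2 * kern n k"
    unfolding num kern_def by (simp add: power2_eq_square)
  finally show ?thesis unfolding N_def .
qed

text \<open>
  Since \<open>f\<^bsub>n+1\<^esub>(k) - f\<^sub>n(k) = f\<^bsub>n+1\<^esub>(k) k\<^sup>2 / (n + 1)\<^sup>2\<close>, a step in \<open>n\<close> multiplies the weight by
  \<open>k\<^sup>2 / (n + 1)\<^sup>2\<close>. The extra summand \<open>k = n + 1\<close> is covered because \<open>f\<^sub>n(n + 1) = 0\<close>.
\<close>

lemma sum_kern_Suc:
  "(\<Sum>k=1..Suc n. kern (Suc n) k * w k) =
     (\<Sum>k=1..n. kern n k * w k) + (\<Sum>k=1..Suc n. kern (Suc n) k * (real k ^ 2 * w k)) / real (Suc n) ^ 2"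
proof -
  have "(\<Sum>k=1..n. kern n k * w k) = (\<Sum>k=1..Suc n. kern n k * w k)"
    by (simp add: kern_eq_0)
  also have "\<dots> = (\<Sum>k=1..Suc n. kern (Suc n) k * w k
      - kern (Suc n) k * (real k ^ 2 * w k) / real (Suc n) ^ 2)"
  proof (intro sum.cong refl)
    fix k assume "k \<in> {1..Suc n}"
    then have eq: "kern n k = kern (Suc n) k * (real (Suc n) ^ 2 - real k ^ 2) / real (Suc n) ^ 2"
      using kern_Suc_left[of k n] by (simp add: field_simps del: of_nat_Suc)
    show "kern n k * w k = kern (Suc n) k * w k
      - kern (Suc n) k * (real k ^ 2 * w k) / real (Suc n) ^ 2"
      unfolding eq by (simp add: divide_simps algebra_simps del: of_nat_Suc)
  qed
  finally show ?thesis
    by (simp add: sum_subtractf sum_divide_distrib del: of_nat_Suc sum.cl_ivl_Suc)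
qed

text \<open>
  By the recursion of the kernel in \<open>k\<close>, the summand is a difference of consecutive values of
  \<open>- f\<^sub>n(k) (n + k) X(k - 1)\<close>; the upper boundary term vanishes, and the lower one is evaluated
  with \<open>(n + 1) f\<^sub>n(1) = n\<close>.
\<close>

lemma sum_kern_telescope:
  "(\<Sum>k=1..n. kern n k * ((real n - real k) * X k + (real n + real k) * X (k - 1))) = real n * X 0"
proof -
  define G where "G k = - (kern n k * (real n + real k) * X (k - 1))" for k
  have "(\<Sum>k=1..n. kern n k * ((real n - real k) * X k + (real n + real k) * X (k - 1))) =
      (\<Sum>k=1..n. G (Suc k) - G k)"
  proof (intro sum.cong refl)
    fix k assume "k \<in> {1..n}"
    then show "kern n k * ((real n - real k) * X k + (real n + real k) * X (k - 1)) = G (Suc k) - G k"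
      using arg_cong[OF kern_Suc_right[of k n], of "\<lambda>x. x * X k"]
      by (simp add: G_def algebra_simps)
  qed
  also have "\<dots> = G (Suc n) - G 1"
    by (rule sum_Suc_diff) simp
  also have "\<dots> = real n * X 0"
    by (simp add: G_def kern_eq_0, simp add: kern_def field_simps)
  finally show ?thesis .
qed

text \<open>
  Both sides of the conclusion vanish at \<open>n = 0\<close>, and the hypothesis says that their increments
  from \<open>n - 1\<close> to \<open>n\<close> agree.
\<close>

lemma mhs_star_snoc_eq_sum_kern:
  assumes "\<And>n. n \<ge> 1 \<Longrightarrow>
    mhs_star n s / real n ^ x = 2 * (\<Sum>k=1..n. kern n k * (real k ^ 2 * w k)) / real n ^ 2"
  shows "mhs_star n (s @ [x]) = 2 * (\<Sum>k=1..n. kern n k * w k)"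
proof (induction n)
  case 0
  then show ?case by (simp add: mhs_star_eq_tuple_sum tuple_sum_0)
next
  case (Suc n)
  then show ?case
    using assms[of "Suc n"] unfolding mhs_star_Suc_snoc sum_kern_Suc[of n w] by simp
qed

text \<open>
  The base case \<open>2 \<Sum>\<^sub>k f\<^sub>n(k) = 1\<close> is the telescoping sum for \<open>X = 1\<close>. It fails for \<open>n = 0\<close>, whence
  the hypothesis.
\<close>

lemma mhs_star_twos:
  assumes "n \<ge> 1"
  shows "mhs_star n (replicate a 2) = 2 * (\<Sum>k=1..n. kern n k * (1 / real k ^ (2 * a)))"
  using assms
proof (induction a arbitrary: n)
  case 0
  have "real n * (2 * (\<Sum>k=1..n. kern n k)) = real n"
    using sum_kern_telescope[of n "\<lambda>_. 1"] by (simp add: sum_distrib_left algebra_simps)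
  then show ?case
    using 0 by (simp add: mhs_star_eq_tuple_sum tuple_sum_Nil)
next
  case (Suc a)
  have "mhs_star n (replicate a 2 @ [2]) = 2 * (\<Sum>k=1..n. kern n k * (1 / real k ^ (2 * Suc a)))"
  proof (rule mhs_star_snoc_eq_sum_kern)
    fix n :: nat assume "n \<ge> 1"
    moreover have "(\<Sum>k=1..n. kern n k * (real k ^ 2 * (1 / real k ^ (2 * Suc a)))) =
        (\<Sum>k=1..n. kern n k * (1 / real k ^ (2 * a)))"
      by (intro sum.cong refl) (simp add: power2_eq_square)
    ultimately show "mhs_star n (replicate a 2) / real n ^ 2 =
        2 * (\<Sum>k=1..n. kern n k * (real k ^ 2 * (1 / real k ^ (2 * Suc a)))) / real n ^ 2"
      using Suc.IH by simp
  qed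
  then show ?case by (simp add: replicate_append_same)
qed

section \<open>Weighted sums over compositions\<close>

definition head_comps :: "nat \<Rightarrow> (nat \<times> nat list) set" where
  "head_comps d = {(i, s). i \<ge> 1 \<and> (\<forall>x\<in>set s. x \<ge> 1) \<and> i + sum_list s = d}"

text \<open>
  As a generating function in \<open>t\<close>, \<open>\<Sum>\<^sub>d B\<^sub>d(n) t\<^sup>d\<close> is the sum over \<open>1 \<le> l \<le> n\<close> of
  \<open>l\<^bsup>-2a\<^esup> t / (l - t)\<close> times the product of \<open>(m + t) / (m - t)\<close> over \<open>l < m \<le> n\<close>: the factor
  \<open>2\<^bsup>l(s)\<^esup>\<close> arises from \<open>(m + t) / (m - t) = 1 + 2 \<Sum>\<^bsub>x\<ge>1\<^esub> (t / m)\<^sup>x\<close>. This is the \<open>B\<close> of the introduction,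
  and \<open>split_sum\<close> is its \<open>U\<close>.
\<close>

definition comp_sum :: "nat \<Rightarrow> nat \<Rightarrow> nat \<Rightarrow> real" where
  "comp_sum a d n = (\<Sum>(i, s)\<in>head_comps d. 2 ^ length s * mhs n ((2 * a + i) # s))"

definition split_sum :: "nat \<Rightarrow> nat \<Rightarrow> nat \<Rightarrow> real" where
  "split_sum a d k = 1 / real k ^ (2 * a + d) + 2 * (\<Sum>j\<le>d. comp_sum a (d - j) (k - 1) / real k ^ j)"

lemma finite_head_comps: "finite (head_comps d)"
proof -
  have "(\<lambda>(i, s). (i, 2, s)) ` head_comps d \<subseteq> split_index (d + 2)"
    by (auto simp: head_comps_def split_index_def)
  then show ?thesis
    by (rule finite_imageD[OF finite_subset[OF _ finite_split_index]]) (auto simp: inj_on_def)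
qed

lemma head_comps_0: "head_comps 0 = {}"
  by (auto simp: head_comps_def)

lemma comp_sum_0: "comp_sum a 0 n = 0"
  by (simp add: comp_sum_def head_comps_0)

lemma comp_sum_at_0: "comp_sum a d 0 = 0"
  by (simp add: comp_sum_def mhs_eq_tuple_sum tuple_sum_0)

text \<open>
  The last part of a composition is the exponent of the largest index, on which the recursion of
  the harmonic sums in \<open>n\<close> acts.
\<close>

lemma head_comps_snoc:
  assumes "d \<ge> 1"
  shows "head_comps d =
    insert (d, []) ((\<lambda>(j, i, s). (i, s @ [j])) ` (SIGMA j:{1..d}. head_comps (d - j)))"
    (is "?L = ?R")
proof (intro equalityI subsetI)
  fix p assume p: "p \<in> ?L"
  then obtain i s where eq: "p = (i, s)" by (cases p)
  show "p \<in> ?R"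
  proof (cases s rule: rev_cases)
    case Nil
    then show ?thesis using p eq by (auto simp: head_comps_def)
  next
    case (snoc t j)
    then have "(j, i, t) \<in> (SIGMA j:{1..d}. head_comps (d - j))"
      using p eq by (auto simp: head_comps_def)
    then show ?thesis unfolding eq snoc by force
  qed
next
  fix p assume "p \<in> ?R"
  then show "p \<in> ?L" using assms by (auto simp: head_comps_def)
qed

lemma comp_sum_Suc:
  assumes "d \<ge> 1"
  shows "comp_sum a d (Suc n) = comp_sum a d n + 1 / real (Suc n) ^ (2 * a + d)
    + 2 * (\<Sum>j=1..d. comp_sum a (d - j) n / real (Suc n) ^ j)"
proof -
  let ?K = "SIGMA j:{1..d}. head_comps (d - j)"
  let ?g = "\<lambda>(j :: nat, i :: nat, s). (i, s @ [j])"
  define D where "D = (\<lambda>(i, s). 2 ^ length s *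
    (mhs (Suc n) ((2 * a + i) # s) - mhs n ((2 * a + i) # s)))"
  have "comp_sum a d (Suc n) - comp_sum a d n = (\<Sum>p\<in>head_comps d. D p)"
    unfolding comp_sum_def D_def sum_subtractf[symmetric]
    by (intro sum.cong refl) (auto simp: algebra_simps)
  also have "\<dots> = D (d, []) + (\<Sum>p\<in>?g ` ?K. D p)"
    unfolding head_comps_snoc[OF assms]
    by (rule sum.insert) (auto simp: finite_head_comps)
  also have "(\<Sum>p\<in>?g ` ?K. D p) = (\<Sum>p\<in>?K. D (?g p))"
    by (subst sum.reindex) (auto simp: inj_on_def)
  also have "\<dots> = (\<Sum>j=1..d. \<Sum>p\<in>head_comps (d - j). D (?g (j, p)))"
    by (subst sum.Sigma) (auto simp: finite_head_comps intro!: sum.cong)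
  also have "\<dots> = (\<Sum>j=1..d. 2 * (comp_sum a (d - j) n / real (Suc n) ^ j))"
  proof (intro sum.cong refl)
    fix j
    have "D (?g (j, i, s)) = 2 * (2 ^ length s * mhs n ((2 * a + i) # s)) / real (Suc n) ^ j" for i s
      using mhs_Suc_snoc[of n "(2 * a + i) # s" j] by (simp add: D_def del: of_nat_Suc)
    then show "(\<Sum>p\<in>head_comps (d - j). D (?g (j, p))) = 2 * (comp_sum a (d - j) n / real (Suc n) ^ j)"
      unfolding comp_sum_def sum_distrib_left sum_divide_distrib
      by (intro sum.cong refl) auto
  qed
  also have "D (d, []) = 1 / real (Suc n) ^ (2 * a + d)"
    using mhs_Suc_snoc[of n "[]" "2 * a + d"]
    by (simp add: D_def mhs_eq_tuple_sum tuple_sum_Nil del: of_nat_Suc)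
  finally show ?thesis by (simp add: sum_distrib_left)
qed

text \<open>
  The summand \<open>j = 0\<close> of \<open>split_sum\<close> contributes \<open>comp_sum a d (k - 1)\<close> twice: one copy, with all the
  other summands, builds up \<open>comp_sum a d k\<close>, and the other one remains.
\<close>

lemma split_sum_eq_add:
  assumes "d \<ge> 1" "k \<ge> 1"
  shows "split_sum a d k = comp_sum a d k + comp_sum a d (k - 1)"
proof -
  obtain n where k: "k = Suc n" using assms by (cases k) auto
  have "(\<Sum>j\<le>d. comp_sum a (d - j) n / real (Suc n) ^ j) =
      comp_sum a d n + (\<Sum>j=1..d. comp_sum a (d - j) n / real (Suc n) ^ j)"
    by (simp add: sum.atLeast0_atMost_Suc_shift atMost_atLeast0 sum.atLeast_Suc_atMost del: of_nat_Suc)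
  then show ?thesis
    using comp_sum_Suc[OF assms(1), of a n] by (simp add: split_sum_def k del: of_nat_Suc)
qed

lemma split_sum_Suc:
  assumes "k \<ge> 1"
  shows "real k * split_sum a (Suc d) k = split_sum a d k + 2 * real k * comp_sum a (Suc d) (k - 1)"
proof -
  have "(\<Sum>j\<le>Suc d. comp_sum a (Suc d - j) (k - 1) / real k ^ j) =
      comp_sum a (Suc d) (k - 1) + (\<Sum>j\<le>d. comp_sum a (d - j) (k - 1) / real k ^ j) / real k"
    unfolding sum.atMost_Suc_shift by (simp add: sum_divide_distrib mult.commute)
  then show ?thesis
    using assms unfolding split_sum_def by (simp add: algebra_simps del: sum.atMost_Suc)
qed

text \<open>
  Raising \<open>d\<close> by one divides the sum by \<open>n\<close>: the two expressions of \<open>split_sum a (Suc d)\<close> above turn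
  \<open>n * split_sum a (Suc d) k - split_sum a d k\<close> into the summand that telescopes, for
  \<open>X = comp_sum a (Suc d)\<close>, to \<open>n X(0) = 0\<close>.
\<close>

lemma sum_kern_split_sum:
  assumes "n \<ge> 1"
  shows "(\<Sum>k=1..n. kern n k * split_sum a d k) =
    (\<Sum>k=1..n. kern n k * (1 / real k ^ (2 * a))) / real n ^ d"
proof (induction d)
  case 0
  then show ?case by (simp add: split_sum_def comp_sum_0)
next
  case (Suc d)
  have "real n * (\<Sum>k=1..n. kern n k * split_sum a (Suc d) k) - (\<Sum>k=1..n. kern n k * split_sum a d k) =
     (\<Sum>k=1..n. kern n k * ((real n - real k) * comp_sum a (Suc d) k + (real n + real k) * comp_sum a (Suc d) (k - 1)))"
    unfolding sum_distrib_left sum_subtractf[symmetric]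
  proof (intro sum.cong refl)
    fix k assume "k \<in> {1..n}"
    then have k: "k \<ge> 1" by simp
    have eq: "split_sum a d k = real k * split_sum a (Suc d) k - 2 * real k * comp_sum a (Suc d) (k - 1)"
      using split_sum_Suc[OF k, of a d] by simp
    then show "real n * (kern n k * split_sum a (Suc d) k) - kern n k * split_sum a d k =
      kern n k * ((real n - real k) * comp_sum a (Suc d) k + (real n + real k) * comp_sum a (Suc d) (k - 1))"
      unfolding eq split_sum_eq_add[OF _ k, of "Suc d", simplified] by (simp add: algebra_simps)
  qed
  also have "\<dots> = 0"
    unfolding sum_kern_telescope[of n "comp_sum a (Suc d)"] by (simp add: comp_sum_at_0)
  finally have "(\<Sum>k=1..n. kern n k * split_sum a (Suc d) k) =
      (\<Sum>k=1..n. kern n k * split_sum a d k) / real n"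
    using assms by (simp add: field_simps)
  then show ?case
    using Suc.IH by (simp add: mult.commute)
qed

text \<open>
  The factor \<open>k\<^sup>-\<^sup>2\<close> at \<open>b = 0\<close> cancels the \<open>k\<^sup>2\<close> that a step in \<open>n\<close> produces; after that
  \<open>sum_kern_split_sum\<close> supplies \<open>n\<^sup>-\<^sup>d\<close>, which together with the \<open>n\<^sup>-\<^sup>2\<close> of the step is the \<open>n\<^sup>-\<^sup>c\<close> of
  the exponent \<open>c = d + 2\<close>.
\<close>

lemma mhs_star_eq_sum_kern_split_sum:
  "mhs_star n (replicate a 2 @ [d + 2] @ replicate b 2) =
     2 * (\<Sum>k=1..n. kern n k * (split_sum a d k / real k ^ (2 * b + 2)))"
proof (induction b arbitrary: n)
  case 0
  have "mhs_star n (replicate a 2 @ [d + 2]) = 2 * (\<Sum>k=1..n. kern n k * (split_sum a d k / real k ^ 2))"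
  proof (rule mhs_star_snoc_eq_sum_kern)
    fix n :: nat assume n: "n \<ge> 1"
    have "(\<Sum>k=1..n. kern n k * (real k ^ 2 * (split_sum a d k / real k ^ 2))) =
        (\<Sum>k=1..n. kern n k * split_sum a d k)"
      by (intro sum.cong refl) simp
    then show "mhs_star n (replicate a 2) / real n ^ (d + 2) =
        2 * (\<Sum>k=1..n. kern n k * (real k ^ 2 * (split_sum a d k / real k ^ 2))) / real n ^ 2"
      using mhs_star_twos[OF n, of a] sum_kern_split_sum[OF n, of a d] by (simp add: power_add power2_eq_square)
  qed
  then show ?case by (simp add: power2_eq_square)
next
  case (Suc b)
  have "mhs_star n ((replicate a 2 @ [d + 2] @ replicate b 2) @ [2]) =
      2 * (\<Sum>k=1..n. kern n k * (split_sum a d k / real k ^ (2 * Suc b + 2)))"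
  proof (rule mhs_star_snoc_eq_sum_kern)
    fix n :: nat
    have "(\<Sum>k=1..n. kern n k * (real k ^ 2 * (split_sum a d k / real k ^ (2 * Suc b + 2)))) =
        (\<Sum>k=1..n. kern n k * (split_sum a d k / real k ^ (2 * b + 2)))"
      by (intro sum.cong refl) (simp add: power2_eq_square)
    then show "mhs_star n (replicate a 2 @ [d + 2] @ replicate b 2) / real n ^ 2 =
        2 * (\<Sum>k=1..n. kern n k * (real k ^ 2 * (split_sum a d k / real k ^ (2 * Suc b + 2)))) / real n ^ 2"
      by (simp only: Suc.IH)
  qed
  then show ?case by (simp add: replicate_append_same)
qed

lemma sum_split_index:
  "(\<Sum>(i, j, s)\<in>split_index (d + 2). h i j s) =
     (\<Sum>j\<le>d. \<Sum>(i, s)\<in>head_comps (d - j). h i (j + 2) s)"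
proof -
  let ?g = "\<lambda>(j :: nat, i :: nat, s :: nat list). (i, j + 2, s)"
  have "split_index (d + 2) = ?g ` (SIGMA j:{..d}. head_comps (d - j))"
  proof (intro equalityI subsetI)
    fix p assume "p \<in> split_index (d + 2)"
    then obtain i j s where p: "p = (i, j, s)" "j \<ge> 2" "i \<ge> 1" "\<forall>x\<in>set s. x \<ge> 1"
      "i + j + sum_list s = d + 2"
      by (auto simp: split_index_def)
    then have "(j - 2, i, s) \<in> (SIGMA j:{..d}. head_comps (d - j))" "p = ?g (j - 2, i, s)"
      by (auto simp: head_comps_def)
    then show "p \<in> ?g ` (SIGMA j:{..d}. head_comps (d - j))" by blast
  qed (auto simp: split_index_def head_comps_def)
  then have "(\<Sum>(i, j, s)\<in>split_index (d + 2). h i j s) =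
      (\<Sum>(j, i, s)\<in>(SIGMA j:{..d}. head_comps (d - j)). h i (j + 2) s)"
    by (simp only:) (subst sum.reindex, auto simp: inj_on_def case_prod_unfold)
  also have "\<dots> = (\<Sum>j\<le>d. \<Sum>(i, s)\<in>head_comps (d - j). h i (j + 2) s)"
    by (subst sum.Sigma) (auto simp: finite_head_comps case_prod_unfold)
  finally show ?thesis .
qed

theorem theorem2p1:
  fixes n a b c :: nat
  assumes "n \<ge> 1" and "c \<ge> 2"
  shows "mhs_star n (replicate a 2 @ [c] @ replicate b 2) =
      2 * (\<Sum>k=1..n. (-1) ^ (k - 1) * real (n choose k) /
                      (real k ^ (2 * a + 2 * b + c) * real ((n + k) choose k)))
    + 4 * (\<Sum>(i, j, s)\<in>split_index c. 2 ^ length s *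
             (\<Sum>k=1..n. mhs (k - 1) ((2 * a + i) # s) * (-1) ^ (k - 1) * real (n choose k) /
                         (real k ^ (2 * b + j) * real ((n + k) choose k))))"
proof -
  define d where "d = c - 2"
  have c: "c = d + 2" using assms(2) by (simp add: d_def)
  have "(\<Sum>(i, j, s)\<in>split_index c. 2 ^ length s *
             (\<Sum>k=1..n. mhs (k - 1) ((2 * a + i) # s) * (-1) ^ (k - 1) * real (n choose k) /
                         (real k ^ (2 * b + j) * real ((n + k) choose k))))
     = (\<Sum>(i, j, s)\<in>split_index c. \<Sum>k=1..n. kern n k / real k ^ (2 * b + j) *
          (2 ^ length s * mhs (k - 1) ((2 * a + i) # s)))"
    by (simp add: sum_distrib_left kern_def mult_ac)
  also have "\<dots> = (\<Sum>k=1..n. \<Sum>(i, j, s)\<in>split_index c. kern n k / real k ^ (2 * b + j) *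
          (2 ^ length s * mhs (k - 1) ((2 * a + i) # s)))"
    unfolding case_prod_unfold by (rule sum.swap)
  also have "\<dots> = (\<Sum>k=1..n. \<Sum>j\<le>d. kern n k / real k ^ (2 * b + 2) *
          (comp_sum a (d - j) (k - 1) / real k ^ j))"
    unfolding c sum_split_index comp_sum_def sum_distrib_left sum_divide_distrib
    by (intro sum.cong refl) (auto simp: power_add)
  also have "\<dots> = (\<Sum>k=1..n. kern n k / real k ^ (2 * b + 2) *
          (\<Sum>j\<le>d. comp_sum a (d - j) (k - 1) / real k ^ j))"
    by (simp only: sum_distrib_left)
  finally have 1: "(\<Sum>(i, j, s)\<in>split_index c. 2 ^ length s *
             (\<Sum>k=1..n. mhs (k - 1) ((2 * a + i) # s) * (-1) ^ (k - 1) * real (n choose k) /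
                         (real k ^ (2 * b + j) * real ((n + k) choose k)))) = \<dots>" .
  have 2: "(\<Sum>k=1..n. (-1) ^ (k - 1) * real (n choose k) /
                      (real k ^ (2 * a + 2 * b + c) * real ((n + k) choose k))) =
      (\<Sum>k=1..n. kern n k / real k ^ (2 * b + 2) * (1 / real k ^ (2 * a + d)))"
    by (intro sum.cong refl) (simp add: kern_def c power_add mult_ac)
  show ?thesis
    unfolding 1 2 unfolding c mhs_star_eq_sum_kern_split_sum split_sum_def
    by (simp add: sum_distrib_left sum.distrib[symmetric] algebra_simps add_divide_distrib)
qed

end
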